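(* Testing whether an assignment in $\{0,1\}^{2^h}$ is accepted by the balancing formula of height $h$, with farness parameter $\epsilon=1/4$, requires $\Omega(h)$ queries for any non-adaptive test and $\Omega(\log h)$ queries for any (possibly adaptive) test, whether with $1$-sided or $2$-sided error.
   Context: Alphabet $\Sigma=\{0,1,P,F\}$. The balancing gate takes two inputs from $\Sigma$ and outputs: $0$ on $(0,0)$; $1$ on $(1,1)$; $P$ on $(1,0)$, $(0,1)$ and $(P,P)$; $F$ on every other input pair. The balancing formula of height $h$ is the full balanced binary tree of height $h$ with leaves $x_0,\dots,x_{2^h-1}$ and all internal gates balancing gates; an assignment is accepted if the root value is not $F$. An $\epsilon$-test with $q$ queries is a randomized algorithm that queries at most $q$ values of the unknown assignment, accepts with probability at least $2/3$ every accepted assignment, and rejects with probability at least $2/3$ every assignment whose Hamming distance from every accepted assignment exceeds $\epsilon\cdot 2^h$. It is non-adaptive if its choice of queries does not depend on answers to previous queries. *)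

theory Defs
  imports "HOL-Probability.Probability_Mass_Function" "HOL-Library.FuncSet"
begin

datatype alphabet = Sym0 | Sym1 | SymP | SymF

fun balancing_gate :: "alphabet \<Rightarrow> alphabet \<Rightarrow> alphabet" where
  "balancing_gate Sym0 Sym0 = Sym0"
| "balancing_gate Sym1 Sym1 = Sym1"
| "balancing_gate Sym1 Sym0 = SymP"
| "balancing_gate Sym0 Sym1 = SymP"
| "balancing_gate SymP SymP = SymP"
| "balancing_gate _ _ = SymF"

datatype formula = Var nat | Gate formula formula

primrec formula_value :: "formula \<Rightarrow> (nat \<Rightarrow> alphabet) \<Rightarrow> alphabet" where
  "formula_value (Var i) x = x i"
| "formula_value (Gate l r) x = balancing_gate (formula_value l x) (formula_value r x)"

text \<open>The full binary tree of height \<open>h\<close> whose leaves are, from left to right, the variables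
  \<open>x\<^sub>s, \<dots>\<close> with \<open>2 ^ h\<close> consecutive indices starting at \<open>s\<close>.\<close>

primrec full_tree :: "nat \<Rightarrow> nat \<Rightarrow> formula" where
  "full_tree 0 s = Var s"
| "full_tree (Suc h) s = Gate (full_tree h s) (full_tree h (s + 2 ^ h))"

definition balancing_formula :: "nat \<Rightarrow> formula" where
  "balancing_formula h = full_tree h 0"

definition binary_assignments :: "nat \<Rightarrow> (nat \<Rightarrow> alphabet) set" where
  "binary_assignments h = {..<2 ^ h} \<rightarrow>\<^sub>E {Sym0, Sym1}"

definition accepted_assignments :: "nat \<Rightarrow> (nat \<Rightarrow> alphabet) set" where
  "accepted_assignments h =
     {x \<in> binary_assignments h. formula_value (balancing_formula h) x \<noteq> SymF}"

definition hamming_dist :: "nat \<Rightarrow> (nat \<Rightarrow> 'a) \<Rightarrow> (nat \<Rightarrow> 'a) \<Rightarrow> nat" where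
  "hamming_dist n x y = card {i. i < n \<and> x i \<noteq> y i}"

text \<open>A deterministic query algorithm is a decision tree: \<open>Query i k\<close> reads the value \<open>x i\<close> and
  continues with \<open>k (x i)\<close>; \<open>Decide True\<close> accepts. A randomized algorithm is a probability
  distribution on decision trees.\<close>

datatype 'a decision_tree = Decide bool | Query nat "'a \<Rightarrow> 'a decision_tree"

primrec accepts :: "'a decision_tree \<Rightarrow> (nat \<Rightarrow> 'a) \<Rightarrow> bool" where
  "accepts (Decide b) x = b"
| "accepts (Query i k) x = accepts (k (x i)) x"

primrec queries :: "'a decision_tree \<Rightarrow> (nat \<Rightarrow> 'a) \<Rightarrow> nat list" where
  "queries (Decide b) x = []"
| "queries (Query i k) x = i # queries (k (x i)) x"

datatype error_type = One_Sided | Two_Sided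

fun min_accept_prob :: "error_type \<Rightarrow> real" where
  "min_accept_prob One_Sided = 1"
| "min_accept_prob Two_Sided = 2 / 3"

text \<open>\<open>D\<close> is the set of possible inputs (functions on \<open>{..<n}\<close>) and \<open>S \<subseteq> D\<close> the tested property.
  The bounds on the queries have to hold for every outcome of the coin tosses.\<close>

definition is_test ::
  "error_type \<Rightarrow> nat \<Rightarrow> (nat \<Rightarrow> 'a) set \<Rightarrow> (nat \<Rightarrow> 'a) set \<Rightarrow> real \<Rightarrow> nat \<Rightarrow> 'a decision_tree pmf \<Rightarrow> bool"
where
  "is_test err n D S \<epsilon> q A \<longleftrightarrow>
     (\<forall>t \<in> set_pmf A. \<forall>x \<in> D. set (queries t x) \<subseteq> {..<n} \<and> length (queries t x) \<le> q) \<and>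
     (\<forall>x \<in> S. measure_pmf.prob A {t. accepts t x} \<ge> min_accept_prob err) \<and>
     (\<forall>x \<in> D. (\<forall>y \<in> S. real (hamming_dist n x y) > \<epsilon> * real n) \<longrightarrow>
        measure_pmf.prob A {t. \<not> accepts t x} \<ge> 2 / 3)"

definition non_adaptive :: "(nat \<Rightarrow> 'a) set \<Rightarrow> 'a decision_tree pmf \<Rightarrow> bool" where
  "non_adaptive D A \<longleftrightarrow>
     (\<forall>t \<in> set_pmf A. \<forall>x \<in> D. \<forall>y \<in> D. queries t x = queries t y)"

definition balancing_test ::
  "error_type \<Rightarrow> nat \<Rightarrow> real \<Rightarrow> nat \<Rightarrow> alphabet decision_tree pmf \<Rightarrow> bool" where
  "balancing_test err h \<epsilon> q A \<longleftrightarrow>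
     is_test err (2 ^ h) (binary_assignments h) (accepted_assignments h) \<epsilon> q A"

end

theory Submission
  imports Defs
begin

text \<open>Replace the leaves by cells of \<open>2 ^ k\<close> consecutive variables and fill every group of 16 cells
  with a fixed pattern or, depending on a random sign, its complement. For the pattern
  \<open>0\<^sup>81\<^sup>8\<close> the assignment is accepted; for the pattern 0000000100010111 it has relative distance at
  least 5/16 from every accepted assignment. Queries that never meet two different cells of the same
  group see only independent random signs in both cases. A query set \<open>Q\<close> violates this condition
  for at most \<open>|Q|\<close> of the scales \<open>k = 0, 4, 8, \<dots>\<close>, so a test has to be able to look at
  \<open>\<Omega>(h)\<close> positions. An adaptive test with \<open>q\<close> queries to a binary assignment can reach fewer than
  \<open>2 ^ q\<close> positions.\<close>

section \<open>Dyadic blocks\<close>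

text \<open>Indexing by the quotient makes the halves of a block the blocks \<open>2 * u\<close> and
  \<open>Suc (2 * u)\<close> one level down, matching the two subtrees of a gate.\<close>

definition block :: "nat \<Rightarrow> nat \<Rightarrow> nat set" where
  "block k u = {i. i div 2 ^ k = u}"

lemma block_eq_interval: "block k u = {u * 2 ^ k..<Suc u * 2 ^ k}"
  using dividend_less_div_times[of "2 ^ k"]
  by (auto simp: block_def add.commute mult.commute intro: div_nat_eqI)

lemma finite_block [simp]: "finite (block k u)"
  by (simp add: block_eq_interval)

lemma card_block [simp]: "card (block k u) = 2 ^ k"
  by (simp add: block_eq_interval)

lemma block_0 [simp]: "block 0 u = {u}"
  by (auto simp: block_def)

lemma block_Suc: "block (Suc k) u = block k (2 * u) \<union> block k (Suc (2 * u))"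
proof -
  have "i div 2 ^ Suc k = i div 2 ^ k div 2" for i :: nat
    by (simp add: div_mult2_eq power_Suc2 del: power_Suc)
  then show ?thesis
    by (auto simp: block_def)
qed

lemma block_disjoint: "u \<noteq> w \<Longrightarrow> block k u \<inter> block k w = {}"
  by (auto simp: block_def)

definition block_dist :: "nat \<Rightarrow> nat \<Rightarrow> (nat \<Rightarrow> 'a) \<Rightarrow> (nat \<Rightarrow> 'a) \<Rightarrow> nat" where
  "block_dist k u x y = card {i \<in> block k u. x i \<noteq> y i}"

lemma block_dist_Suc:
  "block_dist (Suc k) u x y = block_dist k (2 * u) x y + block_dist k (Suc (2 * u)) x y"
proof -
  have "{i \<in> block (Suc k) u. x i \<noteq> y i} =
      {i \<in> block k (2 * u). x i \<noteq> y i} \<union> {i \<in> block k (Suc (2 * u)). x i \<noteq> y i}"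
    by (auto simp: block_Suc)
  then show ?thesis
    unfolding block_dist_def using block_disjoint[of "2 * u" "Suc (2 * u)" k]
    by (simp, intro card_Un_disjoint) auto
qed

lemma block_dist_cong:
  assumes "\<And>i. i \<in> block k u \<Longrightarrow> y i = z i"
  shows "block_dist k u x y = block_dist k u x z"
  unfolding block_dist_def using assms by (intro arg_cong[of _ _ card]) auto

lemma hamming_dist_block: "hamming_dist (2 ^ h) x y = block_dist h 0 x y"
  by (simp add: hamming_dist_def block_dist_def block_eq_interval atLeast0LessThan)

section \<open>Gate values over dyadic blocks\<close>

definition tree_value :: "nat \<Rightarrow> nat \<Rightarrow> (nat \<Rightarrow> alphabet) \<Rightarrow> alphabet" where
  "tree_value k u x = formula_value (full_tree k (u * 2 ^ k)) x"

lemma tree_value_Suc: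
  "tree_value (Suc k) u x = balancing_gate (tree_value k (2 * u) x) (tree_value k (Suc (2 * u)) x)"
  by (simp add: tree_value_def mult.assoc mult.left_commute add.commute)

lemma tree_value_0 [simp]: "tree_value 0 u x = x u"
  by (simp add: tree_value_def)

abbreviation binary :: "alphabet \<Rightarrow> bool" where
  "binary a \<equiv> a = Sym0 \<or> a = Sym1"

lemma gate_cases:
  shows "balancing_gate a b = SymP \<longleftrightarrow>
      a = Sym1 \<and> b = Sym0 \<or> a = Sym0 \<and> b = Sym1 \<or> a = SymP \<and> b = SymP"
    and "balancing_gate a b = Sym0 \<longleftrightarrow> a = Sym0 \<and> b = Sym0"
    and "balancing_gate a b = Sym1 \<longleftrightarrow> a = Sym1 \<and> b = Sym1"
  by (cases a; cases b; simp)+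

text \<open>A gate outputs 0 or 1 only if both inputs equal that bit, so a bit at the top forces it
  on all leaves.\<close>

lemma tree_value_eq_binary_iff:
  assumes "binary c"
  shows "tree_value k u x = c \<longleftrightarrow> (\<forall>i \<in> block k u. x i = c)"
proof (induction k arbitrary: u)
  case (Suc k)
  have "tree_value (Suc k) u x = c \<longleftrightarrow> tree_value k (2 * u) x = c \<and> tree_value k (Suc (2 * u)) x = c"
    unfolding tree_value_Suc using assms gate_cases by metis
  then show ?case
    using Suc by (auto simp: block_Suc)
qed simp

section \<open>Distance to balanced assignments\<close>

text \<open>The parameters \<open>a\<close> and \<open>p\<close> are relative distances, to the constant \<open>v\<close> and to
  the assignments of value \<open>P\<close>.\<close>

definition far_block :: "alphabet \<Rightarrow> nat \<Rightarrow> nat \<Rightarrow> (nat \<Rightarrow> alphabet) \<Rightarrow> real \<Rightarrow> real \<Rightarrow> bool" where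
  "far_block v k u x a p \<longleftrightarrow>
     (\<forall>i \<in> block k u. binary (x i)) \<and> real (block_dist k u x (\<lambda>_. v)) = a * 2 ^ k \<and>
     (\<forall>y. tree_value k u y = SymP \<longrightarrow> p * 2 ^ k \<le> real (block_dist k u x y))"

text \<open>On a binary block every position differs from exactly one of the two constants.\<close>

lemma block_dist_complement:
  assumes "\<forall>i \<in> block k u. binary (x i)" "binary v" "binary w" "v \<noteq> w"
  shows "real (block_dist k u x (\<lambda>_. w)) = 2 ^ k - real (block_dist k u x (\<lambda>_. v))"
proof -
  have "block k u = {i \<in> block k u. x i \<noteq> v} \<union> {i \<in> block k u. x i \<noteq> w}"
    using assms by auto
  then have "card (block k u) = card ({i \<in> block k u. x i \<noteq> v} \<union> {i \<in> block k u. x i \<noteq> w})"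
    by simp
  also have "\<dots> = block_dist k u x (\<lambda>_. v) + block_dist k u x (\<lambda>_. w)"
    unfolding block_dist_def using assms by (intro card_Un_disjoint) auto
  finally have "real (2 ^ k) = real (block_dist k u x (\<lambda>_. v) + block_dist k u x (\<lambda>_. w))"
    by simp
  then show ?thesis
    by simp
qed

lemma far_block_complement:
  assumes "far_block v k u x a p" "binary v" "binary w" "v \<noteq> w"
  shows "far_block w k u x (1 - a) p"
  using assms block_dist_complement[of k u x v w] unfolding far_block_def
  by (auto simp: algebra_simps)

lemma far_block_const_dist:
  assumes "far_block v k u x a p" "binary v" "binary c" "tree_value k u y = c"
  shows "real (block_dist k u x y) = (if c = v then a else 1 - a) * 2 ^ k"
proof -
  have "block_dist k u x y = block_dist k u x (\<lambda>_. c)"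
    using assms tree_value_eq_binary_iff[of c k u y] by (intro block_dist_cong) auto
  then show ?thesis
    using assms far_block_complement[OF assms(1,2,3)] by (auto simp: far_block_def)
qed

text \<open>A gate yields \<open>SymP\<close> from two halves of value \<open>SymP\<close>, at cost
  at least \<open>p1 + p2\<close> in units of \<open>2 ^ k\<close>, or from opposite constants, at
  cost at least \<open>1 - |a1 - a2|\<close>. Halving these costs for the parent gives the two
  conditions on \<open>p\<close>.\<close>

lemma far_block_Suc:
  assumes "far_block v k u1 x a1 p1" "far_block v k u2 x a2 p2"
    and v: "binary v" and u: "u1 = 2 * u" "u2 = Suc (2 * u)" and a: "a = (a1 + a2) / 2"
    and p: "p \<le> (p1 + p2) / 2" "\<bar>a1 - a2\<bar> \<le> 1 - 2 * p"
  shows "far_block v (Suc k) u x a p"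
proof -
  have 1: "far_block v k (2 * u) x a1 p1" and 2: "far_block v k (Suc (2 * u)) x a2 p2"
    using assms by simp_all
  have "p * 2 ^ Suc k \<le> real (block_dist (Suc k) u x y)" if y: "tree_value (Suc k) u y = SymP" for y
  proof -
    let ?l = "tree_value k (2 * u) y" and ?r = "tree_value k (Suc (2 * u)) y"
    consider (P) "?l = SymP" "?r = SymP" | (binary) "binary ?l" "binary ?r" "?l \<noteq> ?r"
      using y unfolding tree_value_Suc gate_cases by auto
    then obtain d where d: "d * 2 ^ k \<le> real (block_dist (Suc k) u x y)" "2 * p \<le> d"
    proof cases
      case P
      then have "p1 * 2 ^ k + p2 * 2 ^ k \<le> real (block_dist (Suc k) u x y)"
        using 1 2 unfolding far_block_def block_dist_Suc by fastforce
      then show ?thesis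
        using p by (intro that[of "p1 + p2"]) (auto simp: algebra_simps)
    next
      case binary
      \<comment> \<open>For opposite constants \<open>d\<close> is \<open>1 + a1 - a2\<close> or
        \<open>1 - a1 + a2\<close>.\<close>
      define d where "d = (if ?l = v then a1 else 1 - a1) + (if ?r = v then a2 else 1 - a2)"
      have "d * 2 ^ k = real (block_dist (Suc k) u x y)"
        using far_block_const_dist[OF 1 v binary(1) refl] far_block_const_dist[OF 2 v binary(2) refl]
        unfolding d_def by (simp add: block_dist_Suc distrib_right)
      moreover have "2 * p \<le> d"
        using binary v p unfolding d_def by (auto simp: abs_if split: if_splits)
      ultimately show ?thesis
        by (intro that[of d]) auto
    qed
    have "p * 2 ^ Suc k = 2 * p * 2 ^ k"
      by simp
    also have "\<dots> \<le> d * 2 ^ k"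
      using \<open>2 * p \<le> d\<close> by (intro mult_right_mono) auto
    finally show ?thesis
      using d(1) by linarith
  qed
  moreover have "real (block_dist (Suc k) u x (\<lambda>_. v)) = a * 2 ^ Suc k"
    using 1 2 by (simp add: far_block_def block_dist_Suc a distrib_right)
  ultimately show ?thesis
    using 1 2 by (auto simp: far_block_def block_Suc)
qed

text \<open>A single leaf of value \<open>SymP\<close> differs from the bit \<open>c\<close>. Above
  the leaves, both halves have the same \<open>a\<close>, so \<open>far_block_Suc\<close> preserves
  the bound 1/2.\<close>

lemma far_block_const:
  assumes "\<forall>i \<in> block k u. x i = c" "binary c" "binary v"
  shows "far_block v k u x (of_bool (c \<noteq> v)) (1 / 2)"
  using assms(1)
proof (induction k arbitrary: u)
  case 0
  have "block_dist 0 u x y = of_bool (y u \<noteq> c)" for y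
  proof -
    have "{i \<in> block 0 u. x i \<noteq> y i} = (if y u \<noteq> c then {u} else {})"
      using 0 by auto
    then show ?thesis by (simp add: block_dist_def)
  qed
  then show ?case
    using 0 assms(2,3) by (auto simp: far_block_def)
next
  case (Suc k)
  show ?case
    by (rule far_block_Suc[OF Suc.IH Suc.IH]) (use Suc.prems assms in \<open>auto simp: block_Suc\<close>)
qed

section \<open>Hard assignments\<close>

text \<open>\<open>\<beta>\<close> holds the positions of the ones in the pattern and
  \<open>\<sigma>\<close> the complemented groups. With \<open>\<beta> = {}\<close> only the sign
  remains, which serves as the common reference for both patterns.\<close>

definition cell :: "nat set \<Rightarrow> nat set \<Rightarrow> nat \<Rightarrow> alphabet" where
  "cell \<beta> \<sigma> w = (if (w div 16 \<in> \<sigma>) \<noteq> (w mod 16 \<in> \<beta>) then Sym1 else Sym0)"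

definition patterned :: "nat \<Rightarrow> nat \<Rightarrow> nat set \<Rightarrow> nat set \<Rightarrow> nat \<Rightarrow> alphabet" where
  "patterned h k \<beta> \<sigma> = (\<lambda>i\<in>{..<2 ^ h}. cell \<beta> \<sigma> (i div 2 ^ k))"

lemma binary_cell [simp]: "cell \<beta> \<sigma> w = Sym0 \<or> cell \<beta> \<sigma> w = Sym1"
  by (simp add: cell_def)

lemma patterned_binary: "patterned h k \<beta> \<sigma> \<in> binary_assignments h"
  unfolding patterned_def binary_assignments_def by (auto simp: cell_def)

lemma block_less:
  assumes "i \<in> block k w" "w < 2 ^ d" "h = k + d"
  shows "i < 2 ^ h"
proof -
  have "i div 2 ^ k < 2 ^ d"
    using assms by (simp add: block_def)
  then have "i < 2 ^ d * 2 ^ k"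
    by (simp add: div_less_iff_less_mult)
  then show ?thesis
    using assms by (simp add: power_add mult.commute)
qed

text \<open>Here \<open>d\<close> counts the levels above the groups: there are \<open>2 ^ d\<close>
  groups of 16 cells each.\<close>

lemma patterned_block:
  assumes "i \<in> block k w" "w < 2 ^ (4 + d)" "h = k + 4 + d"
  shows "patterned h k \<beta> \<sigma> i = cell \<beta> \<sigma> w"
proof -
  have "i < 2 ^ h"
    using block_less[OF assms(1,2)] assms(3) by (simp add: add.assoc)
  then show ?thesis
    using assms(1) by (simp add: patterned_def block_def)
qed

text \<open>The halves 00000001 and 00010111 of the second pattern have \<open>(a, p) = (1/8, 3/8)\<close> and
  \<open>(1/2, 1/4)\<close>. By \<open>far_block_Suc\<close> they combine to \<open>(5/16, 5/16)\<close>, and the bound 5/16 on \<open>p\<close> survives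
  all further combinations of such blocks and their complements.\<close>

definition accepted_pattern :: "nat set" where
  "accepted_pattern = {8..<16}"

definition far_pattern :: "nat set" where
  "far_pattern = {7, 11, 13, 14, 15}"

text \<open>The two halves of a group are opposite constants, whatever the sign.\<close>

lemma accepted_pattern_block:
  assumes "b < 2 ^ d" "h = k + 4 + d"
  shows "tree_value (k + 4) b (patterned h k accepted_pattern \<sigma>) = SymP"
proof -
  let ?x = "patterned h k accepted_pattern \<sigma>"
  have *: "tree_value (k + 3) (2 * b + e) ?x = (if (b \<in> \<sigma>) \<noteq> (e = 1) then Sym1 else Sym0)"
    if "e < 2" for e
  proof -
    have "?x i = (if (b \<in> \<sigma>) \<noteq> (e = 1) then Sym1 else Sym0)" if "i \<in> block (k + 3) (2 * b + e)" for i
    proof -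
      define w where "w = i div 2 ^ k"
      have "i div 2 ^ (k + 3) = w div 8"
        by (simp add: w_def power_add div_mult2_eq)
      then have w: "w div 8 = 2 * b + e"
        using that by (simp add: block_def)
      define r where "r = w mod 8"
      \<comment> \<open>The index of a cell splits into group \<open>b\<close>, half
        \<open>e\<close> and offset \<open>r\<close> within the half.\<close>
      have "w = 8 * e + r + b * 16" "r < 8"
        using w div_mult_mod_eq[of w 8] by (auto simp: r_def)
      then have "w div 16 = b" "w mod 16 = 8 * e + r"
        using \<open>e < 2\<close> by simp_all
      then have "w mod 16 \<in> {8..<16} \<longleftrightarrow> e = 1"
        using \<open>e < 2\<close> \<open>r < 8\<close> by auto
      moreover have "?x i = cell accepted_pattern \<sigma> w"
        using \<open>w div 16 = b\<close> assms(1)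
        by (intro patterned_block[OF _ _ assms(2)]) (auto simp: block_def w_def power_add)
      ultimately show ?thesis
        by (simp add: cell_def accepted_pattern_def \<open>w div 16 = b\<close>)
    qed
    then show ?thesis
      by (subst tree_value_eq_binary_iff) auto
  qed
  have "k + 4 = Suc (k + 3)" by simp
  then show ?thesis
    using *[of 0] *[of 1] unfolding gate_cases \<open>k + 4 = Suc (k + 3)\<close> tree_value_Suc
    by (auto split: if_splits)
qed

lemma tree_value_SymP_lift:
  assumes "\<And>b. b < 2 ^ (d + e) \<Longrightarrow> tree_value k b x = SymP" "b < 2 ^ d"
  shows "tree_value (k + e) b x = SymP"
  using assms
proof (induction e arbitrary: d b)
  case (Suc e)
  have "tree_value (k + e) c x = SymP" if "c < 2 ^ Suc d" for c
    using that Suc.prems(1) by (intro Suc.IH[of "Suc d"]) auto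
  then show ?case
    using Suc.prems(2) unfolding add_Suc_right tree_value_Suc by simp
qed simp

lemma patterned_accepted:
  assumes "h = k + 4 + d"
  shows "patterned h k accepted_pattern \<sigma> \<in> accepted_assignments h"
proof -
  have "tree_value (k + 4 + d) 0 (patterned h k accepted_pattern \<sigma>) = SymP"
    by (rule tree_value_SymP_lift[of 0]) (use accepted_pattern_block assms in auto)
  then show ?thesis
    using patterned_binary assms by (simp add: tree_value_def accepted_assignments_def balancing_formula_def)
qed

text \<open>The reference constant is the value of the zeros of the pattern under the sign of the
  group, so one computation covers both signs.\<close>

lemma far_pattern_block:
  assumes "b < 2 ^ d" "h = k + 4 + d"
  shows "far_block (cell {} \<sigma> (16 * b)) (k + 4) b (patterned h k far_pattern \<sigma>) (5/16) (5/16)"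
proof -
  let ?x = "patterned h k far_pattern \<sigma>"
  define v where "v = cell {} \<sigma> (16 * b)"
  have v: "binary v" by (simp add: v_def)
  have c: "far_block v k (16 * b + u) ?x (of_bool (u \<in> far_pattern)) (1/2)" if "u < 16" for u
  proof -
    have "16 * b + u < 2 ^ (4 + d)"
      using that assms(1) by (simp add: power_add)
    then have "\<forall>i \<in> block k (16 * b + u). ?x i = cell far_pattern \<sigma> (16 * b + u)"
      using patterned_block assms(2) by blast
    then have "far_block v k (16 * b + u) ?x (of_bool (cell far_pattern \<sigma> (16 * b + u) \<noteq> v)) (1/2)"
      by (rule far_block_const) (auto simp: v)
    moreover have "cell far_pattern \<sigma> (16 * b + u) \<noteq> v \<longleftrightarrow> u \<in> far_pattern"
      using that by (simp add: cell_def v_def)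
    ultimately show ?thesis by simp
  qed
  note comb = far_block_Suc[OF _ _ v]
  have p0: "far_block v (Suc k) (8 * b) ?x 0 (1/2)"
    by (rule comb[OF c[of 0] c[of 1]]) (simp_all add: far_pattern_def)
  have p1: "far_block v (Suc k) (8 * b + 1) ?x 0 (1/2)"
    by (rule comb[OF c[of 2] c[of 3]]) (simp_all add: far_pattern_def)
  have p2: "far_block v (Suc k) (8 * b + 2) ?x 0 (1/2)"
    by (rule comb[OF c[of 4] c[of 5]]) (simp_all add: far_pattern_def)
  \<comment> \<open>Two opposite constant cells already form a block of value \<open>SymP\<close>,
    hence \<open>p = 0\<close>.\<close>
  have p3: "far_block v (Suc k) (8 * b + 3) ?x (1/2) 0"
    by (rule comb[OF c[of 6] c[of 7]]) (simp_all add: far_pattern_def)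
  have p4: "far_block v (Suc k) (8 * b + 4) ?x 0 (1/2)"
    by (rule comb[OF c[of 8] c[of 9]]) (simp_all add: far_pattern_def)
  have p5: "far_block v (Suc k) (8 * b + 5) ?x (1/2) 0"
    by (rule comb[OF c[of 10] c[of 11]]) (simp_all add: far_pattern_def)
  have p6: "far_block v (Suc k) (8 * b + 6) ?x (1/2) 0"
    by (rule comb[OF c[of 12] c[of 13]]) (simp_all add: far_pattern_def)
  have p7: "far_block v (Suc k) (8 * b + 7) ?x 1 (1/2)"
    by (rule comb[OF c[of 14] c[of 15]]) (simp_all add: far_pattern_def)
  have q0: "far_block v (Suc (Suc k)) (4 * b) ?x 0 (1/2)"
    by (rule comb[OF p0 p1]) simp_all
  have q1: "far_block v (Suc (Suc k)) (4 * b + 1) ?x (1/4) (1/4)"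
    by (rule comb[OF p2 p3]) simp_all
  have q2: "far_block v (Suc (Suc k)) (4 * b + 2) ?x (1/4) (1/4)"
    by (rule comb[OF p4 p5]) simp_all
  have q3: "far_block v (Suc (Suc k)) (4 * b + 3) ?x (3/4) (1/4)"
    by (rule comb[OF p6 p7]) simp_all
  have r0: "far_block v (Suc (Suc (Suc k))) (2 * b) ?x (1/8) (3/8)"
    by (rule comb[OF q0 q1]) simp_all
  have r1: "far_block v (Suc (Suc (Suc k))) (2 * b + 1) ?x (1/2) (1/4)"
    by (rule comb[OF q2 q3]) simp_all
  \<comment> \<open>Both bounds are attained: \<open>(3/8 + 1/4) / 2 = 5/16\<close> and
    \<open>1/2 - 1/8 = 1 - 2 * 5/16\<close>.\<close>
  have "far_block v (Suc (Suc (Suc (Suc k)))) b ?x (5/16) (5/16)"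
    by (rule comb[OF r0 r1]) simp_all
  then show ?thesis
    by (simp add: v_def numeral_eq_Suc)
qed

text \<open>The interval is closed under averaging, and its width 3/8 equals
  \<open>1 - 2 * 5/16\<close>, as \<open>far_block_Suc\<close> demands. Its symmetry about 1/2
  admits complemented groups.\<close>

lemma far_block_lift:
  assumes "\<And>b. b < 2 ^ (d + e) \<Longrightarrow> \<exists>a \<in> {5/16..11/16}. far_block Sym0 k b x a (5/16)" "b < 2 ^ d"
  shows "\<exists>a \<in> {5/16..11/16}. far_block Sym0 (k + e) b x a (5/16)"
  using assms
proof (induction e arbitrary: d b)
  case (Suc e)
  have IH: "\<exists>a \<in> {5/16..11/16}. far_block Sym0 (k + e) c x a (5/16)" if "c < 2 ^ Suc d" for c
    using that Suc.prems(1) by (intro Suc.IH[of "Suc d"]) auto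
  obtain a1 a2 where a: "a1 \<in> {5/16..11/16}" "a2 \<in> {5/16..11/16}"
    and far: "far_block Sym0 (k + e) (2 * b) x a1 (5/16)"
      "far_block Sym0 (k + e) (Suc (2 * b)) x a2 (5/16)"
    using IH[of "2 * b"] IH[of "Suc (2 * b)"] Suc.prems(2) by auto
  have "far_block Sym0 (Suc (k + e)) b x ((a1 + a2) / 2) (5/16)"
    by (rule far_block_Suc[OF far]) (use a in \<open>auto simp: abs_if\<close>)
  moreover have "(a1 + a2) / 2 \<in> {5/16..11/16}"
    using a by simp
  ultimately show ?case by auto
qed simp

text \<open>At the root, \<open>p\<close>, \<open>a\<close> and \<open>1 - a\<close> bound the
  relative distance to assignments of value \<open>SymP\<close>, \<open>Sym0\<close> and
  \<open>Sym1\<close>; all three are at least 5/16.\<close>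

lemma patterned_far:
  assumes "h = k + 4 + d" "y \<in> accepted_assignments h"
  shows "real (hamming_dist (2 ^ h) (patterned h k far_pattern \<sigma>) y) > 1/4 * real (2 ^ h)"
proof -
  let ?x = "patterned h k far_pattern \<sigma>"
  have "\<exists>a \<in> {5/16..11/16}. far_block Sym0 (k + 4) b ?x a (5/16)" if "b < 2 ^ d" for b
  proof (cases "cell {} \<sigma> (16 * b) = Sym0")
    case True
    then show ?thesis
      using far_pattern_block[OF that assms(1), of \<sigma>] by force
  next
    case False
    then have "cell {} \<sigma> (16 * b) = Sym1"
      using binary_cell by blast
    then have "far_block Sym0 (k + 4) b ?x (1 - 5/16) (5/16)"
      by (intro far_block_complement[OF far_pattern_block[OF that assms(1)]]) simp_all
    then show ?thesis by force
  qed
  then obtain a where a: "a \<in> {5/16..11/16}" "far_block Sym0 h 0 ?x a (5/16)"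
    using far_block_lift[of 0 d "k + 4" ?x 0] assms(1) by auto
  have "tree_value h 0 y \<noteq> SymF"
    using assms(2) by (simp add: accepted_assignments_def balancing_formula_def tree_value_def)
  then have "5/16 * 2 ^ h \<le> real (block_dist h 0 ?x y)"
  proof (cases "tree_value h 0 y")
    case SymP
    then show ?thesis using a by (simp add: far_block_def)
  next
    case Sym0
    then show ?thesis using a far_block_const_dist[OF a(2), of Sym0 y] by simp
  next
    case Sym1
    then show ?thesis using a far_block_const_dist[OF a(2), of Sym1 y] by simp
  qed simp
  then show ?thesis
    unfolding hamming_dist_block by (rule less_le_trans[rotated]) simp
qed

section \<open>Indistinguishability\<close>

text \<open>If \<open>Q\<close> meets at most one cell per group, flipping the signs of suitable
  groups turns one pattern into the other on \<open>Q\<close>. This flip is an involution on the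
  sign sets. Several queries in the same cell are allowed.\<close>

lemma sum_patterned_eq:
  assumes Q: "Q \<subseteq> {..<2 ^ h}" and inj: "inj_on (\<lambda>w. w div 16) ((\<lambda>i. i div 2 ^ k) ` Q)"
    and f: "\<And>x y. x \<in> binary_assignments h \<Longrightarrow> y \<in> binary_assignments h \<Longrightarrow>
      (\<And>i. i \<in> Q \<Longrightarrow> x i = y i) \<Longrightarrow> f x = f y"
  shows "(\<Sum>\<sigma>\<in>Pow {..<2 ^ h}. f (patterned h k \<beta> \<sigma>)) = (\<Sum>\<sigma>\<in>Pow {..<2 ^ h}. f (patterned h k {} \<sigma>))"
proof -
  \<comment> \<open>the groups of cells in which the pattern changes the sign seen by \<open>Q\<close>\<close>
  define T where "T = (\<lambda>w. w div 16) ` {w \<in> (\<lambda>i. i div 2 ^ k) ` Q. w mod 16 \<in> \<beta>}"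
  define flip where "flip \<sigma> = (\<sigma> - T) \<union> (T - \<sigma>)" for \<sigma>
  have "i div 2 ^ k div 16 < 2 ^ h" if "i \<in> Q" for i
    using that Q by (intro le_less_trans[OF div_le_dividend] le_less_trans[OF div_le_dividend]) auto
  then have T: "T \<subseteq> {..<2 ^ h}"
    by (auto simp: T_def)
  have "f (patterned h k {} (flip \<sigma>)) = f (patterned h k \<beta> \<sigma>)" for \<sigma>
  proof (intro f patterned_binary)
    fix i assume "i \<in> Q"
    define w where "w = i div 2 ^ k"
    have "w \<in> (\<lambda>i. i div 2 ^ k) ` Q"
      using \<open>i \<in> Q\<close> by (simp add: w_def)
    then have "w div 16 \<in> T \<longleftrightarrow> w \<in> {w \<in> (\<lambda>i. i div 2 ^ k) ` Q. w mod 16 \<in> \<beta>}"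
      unfolding T_def by (intro inj_on_image_mem_iff[OF inj]) auto
    also have "\<dots> \<longleftrightarrow> w mod 16 \<in> \<beta>"
      using \<open>w \<in> (\<lambda>i. i div 2 ^ k) ` Q\<close> by simp
    finally have "w div 16 \<in> T \<longleftrightarrow> w mod 16 \<in> \<beta>" .
    then have "cell {} (flip \<sigma>) w = cell \<beta> \<sigma> w"
      by (auto simp: cell_def flip_def)
    then show "patterned h k {} (flip \<sigma>) i = patterned h k \<beta> \<sigma> i"
      by (simp add: patterned_def w_def)
  qed
  then show ?thesis
    using T by (intro sum.reindex_bij_witness[where i = flip and j = flip]) (auto simp: flip_def)
qed

text \<open>The number of distinct cells met by \<open>Q\<close> is a potential: it starts at
  \<open>card Q\<close>, never grows with the scale, and drops at every scale where two cells share
  a group.\<close>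

lemma card_non_inj_scales:
  assumes "finite Q"
  shows "card {m \<in> {..<M}. \<not> inj_on (\<lambda>w. w div 16) ((\<lambda>i. i div 2 ^ (4 * m)) ` Q)}
    + card ((\<lambda>i::nat. i div 2 ^ (4 * M)) ` Q) \<le> card Q"
proof (induction M)
  case (Suc M)
  let ?W = "(\<lambda>i::nat. i div 2 ^ (4 * M)) ` Q"
  let ?B = "\<lambda>M. {m \<in> {..<M}. \<not> inj_on (\<lambda>w. w div 16) ((\<lambda>i. i div 2 ^ (4 * m)) ` Q)}"
  have W: "(\<lambda>i. i div 2 ^ (4 * Suc M)) ` Q = (\<lambda>w. w div 16) ` ?W"
    by (simp add: image_image div_mult2_eq[symmetric] power_add mult.commute)
  show ?case
  proof (cases "inj_on (\<lambda>w. w div 16) ?W")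
    case True
    then have "?B (Suc M) = ?B M"
      by (auto simp: less_Suc_eq)
    then show ?thesis
      using Suc card_image_le[of ?W "\<lambda>w. w div 16"] assms unfolding W by simp
  next
    case False
    then have "card ((\<lambda>w. w div 16) ` ?W) \<noteq> card ?W"
      using inj_on_iff_eq_card[of ?W] assms by auto
    then have "card ((\<lambda>w. w div 16) ` ?W) < card ?W"
      using card_image_le[of ?W "\<lambda>w. w div 16"] assms by simp
    moreover have "?B (Suc M) = insert M (?B M)"
      using False by (auto simp: less_Suc_eq)
    then have "card (?B (Suc M)) = Suc (card (?B M))"
      by simp
    ultimately show ?thesis
      using Suc unfolding W by simp
  qed
qed (simp add: assms)

lemma accepts_cong:
  "(\<And>i. i \<in> set (queries t x) \<Longrightarrow> x i = y i) \<Longrightarrow> accepts t x = accepts t y"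
  by (induction t) auto

text \<open>Scales where \<open>Q\<close> separates groups contribute 0, since both patterns agree
  with the pattern \<open>{}\<close>. Each other scale contributes at most the number of sign sets,
  and there are at most \<open>card Q\<close> such scales.\<close>

lemma sum_advantage_le:
  assumes Q: "Q \<subseteq> {..<2 ^ h}"
    and t: "\<And>x. x \<in> binary_assignments h \<Longrightarrow> set (queries t x) \<subseteq> Q"
  shows "(\<Sum>m<M. \<Sum>\<sigma>\<in>Pow {..<2 ^ h}.
      of_bool (accepts t (patterned h (4 * m) \<beta> \<sigma>)) - of_bool (accepts t (patterned h (4 * m) \<gamma> \<sigma>)))
    \<le> real (card Q) * 2 ^ 2 ^ h" (is "(\<Sum>m<M. ?S m) \<le> _")
proof -
  let ?inj = "\<lambda>m. inj_on (\<lambda>w. w div 16) ((\<lambda>i. i div 2 ^ (4 * m)) ` Q)"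
  have "finite Q"
    using Q finite_subset by blast
  have "?S m \<le> of_bool (\<not> ?inj m) * 2 ^ 2 ^ h" for m
  proof (cases "?inj m")
    case True
    have cong: "accepts t x = accepts t y"
      if "x \<in> binary_assignments h" "\<And>i. i \<in> Q \<Longrightarrow> x i = y i" for x y
      using that t by (intro accepts_cong) blast
    then have "(\<Sum>\<sigma>\<in>Pow {..<2 ^ h}. of_bool (accepts t (patterned h (4 * m) \<beta>' \<sigma>))) =
        (\<Sum>\<sigma>\<in>Pow {..<2 ^ h}. of_bool (accepts t (patterned h (4 * m) {} \<sigma>)) :: real)" for \<beta>'
      by (intro sum_patterned_eq[OF Q True] arg_cong[of _ _ of_bool] cong) auto
    from this[of \<beta>] this[of \<gamma>] show ?thesis
      unfolding sum_subtractf by (simp add: True)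
  next
    case False
    have "?S m \<le> real (card (Pow {..<2 ^ h :: nat})) * 1"
      by (intro sum_bounded_above) auto
    then show ?thesis
      using False by (simp add: card_Pow)
  qed
  then have "(\<Sum>m<M. ?S m) \<le> (\<Sum>m<M. of_bool (\<not> ?inj m) * 2 ^ 2 ^ h)"
    by (intro sum_mono)
  also have "\<dots> = real (card {m \<in> {..<M}. \<not> ?inj m}) * 2 ^ 2 ^ h"
    by (simp add: sum_distrib_right[symmetric] Int_def)
  also have "\<dots> \<le> real (card Q) * 2 ^ 2 ^ h"
    using card_non_inj_scales[OF \<open>finite Q\<close>, of M] by (intro mult_right_mono) auto
  finally show ?thesis .
qed

section \<open>Query bounds\<close>

lemma sum_prob_diff_le:
  assumes "finite I"
    and "\<And>t. t \<in> set_pmf A \<Longrightarrow> (\<Sum>i\<in>I. of_bool (P i t) - of_bool (R i t)) \<le> (L :: real)"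
  shows "(\<Sum>i\<in>I. measure_pmf.prob A {t. P i t} - measure_pmf.prob A {t. R i t}) \<le> L"
proof -
  have int: "integrable (measure_pmf A) (\<lambda>t. of_bool (P' t) :: real)" for P'
    by (rule measure_pmf.integrable_const_bound[where B = 1]) auto
  have prob: "measure_pmf.prob A {t. P' t} = measure_pmf.expectation A (\<lambda>t. of_bool (P' t))" for P'
  proof -
    have "(\<lambda>t. of_bool (P' t) :: real) = indicator {t. P' t}"
      by (auto simp: fun_eq_iff)
    then show ?thesis by simp
  qed
  have "(\<Sum>i\<in>I. measure_pmf.prob A {t. P i t} - measure_pmf.prob A {t. R i t}) =
      measure_pmf.expectation A (\<lambda>t. \<Sum>i\<in>I. of_bool (P i t) - of_bool (R i t))"
    by (simp add: prob int)
  also have "\<dots> \<le> L"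
    using assms(2) int by (intro measure_pmf.integral_le_const) (auto simp: AE_measure_pmf_iff)
  finally show ?thesis .
qed

text \<open>Double counting over pairs of a scale and a sign set: the test has advantage at least
  1/3 on every pair, while each tree in its support has total advantage at most
  \<open>L * 2 ^ 2 ^ h\<close>.\<close>

lemma balancing_test_query_set_bound:
  assumes test: "balancing_test err h (1 / 4) q A"
    and Q: "\<And>t. t \<in> set_pmf A \<Longrightarrow>
      card (\<Union>x \<in> binary_assignments h. set (queries t x)) \<le> L"
  shows "real (h div 4) \<le> 3 * real L"
proof -
  define I where "I = {..<h div 4} \<times> Pow {..<2 ^ h :: nat}"
  define Y where "Y = (\<lambda>(m, \<sigma>). patterned h (4 * m) accepted_pattern \<sigma>)"
  define N where "N = (\<lambda>(m, \<sigma>). patterned h (4 * m) far_pattern \<sigma>)"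
  have gap: "1 / 3 \<le> measure_pmf.prob A {t. accepts t (Y i)} - measure_pmf.prob A {t. accepts t (N i)}"
    if "i \<in> I" for i
  proof -
    obtain m \<sigma> where i: "i = (m, \<sigma>)" by fastforce
    \<comment> \<open>From \<open>m < h div 4\<close> follows \<open>4 * m + 4 \<le> h\<close>, so
      the subtraction does not truncate.\<close>
    have h: "h = 4 * m + 4 + (h - 4 * m - 4)"
      using that by (auto simp: I_def i)
    have "Y i \<in> accepted_assignments h"
      unfolding Y_def i using patterned_accepted[OF h] by simp
    then have "min_accept_prob err \<le> measure_pmf.prob A {t. accepts t (Y i)}"
      using test by (simp add: balancing_test_def is_test_def)
    moreover have "min_accept_prob err \<ge> 2 / 3"
      by (cases err) auto
    moreover have "2 / 3 \<le> measure_pmf.prob A {t. \<not> accepts t (N i)}"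
      using test patterned_far[OF h] patterned_binary
      unfolding balancing_test_def is_test_def N_def i by auto
    moreover have "measure_pmf.prob A {t. \<not> accepts t (N i)} = 1 - measure_pmf.prob A {t. accepts t (N i)}"
      using measure_pmf.prob_compl[of "{t. accepts t (N i)}" A]
      by (simp add: Compl_eq_Diff_UNIV[symmetric] Collect_neg_eq)
    ultimately show ?thesis by simp
  qed
  have "(\<Sum>i\<in>I. of_bool (accepts t (Y i)) - of_bool (accepts t (N i))) \<le> real L * 2 ^ 2 ^ h"
    if "t \<in> set_pmf A" for t
  proof -
    let ?Q = "\<Union>x \<in> binary_assignments h. set (queries t x)"
    have "?Q \<subseteq> {..<2 ^ h}"
      using test that by (auto simp: balancing_test_def is_test_def)
    then have "(\<Sum>m<h div 4. \<Sum>\<sigma>\<in>Pow {..<2 ^ h}.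
        of_bool (accepts t (patterned h (4 * m) accepted_pattern \<sigma>)) -
        of_bool (accepts t (patterned h (4 * m) far_pattern \<sigma>))) \<le> real (card ?Q) * 2 ^ 2 ^ h"
      by (rule sum_advantage_le) auto
    also have "\<dots> \<le> real L * 2 ^ 2 ^ h"
      using Q[OF that] by (intro mult_right_mono) auto
    finally show ?thesis
      by (simp add: I_def Y_def N_def sum.cartesian_product case_prod_unfold)
  qed
  then have "(\<Sum>i\<in>I. measure_pmf.prob A {t. accepts t (Y i)} - measure_pmf.prob A {t. accepts t (N i)})
      \<le> real L * 2 ^ 2 ^ h"
    by (intro sum_prob_diff_le) (auto simp: I_def)
  moreover have "real (card I) * (1 / 3) \<le>
      (\<Sum>i\<in>I. measure_pmf.prob A {t. accepts t (Y i)} - measure_pmf.prob A {t. accepts t (N i)})"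
    using gap by (rule sum_bounded_below)
  moreover have "real (card I) = real (h div 4) * 2 ^ 2 ^ h"
    by (simp add: I_def card_cartesian_product card_Pow)
  ultimately have "real (h div 4) * 2 ^ 2 ^ h \<le> 3 * real L * 2 ^ 2 ^ h"
    by linarith
  then show ?thesis
    by (rule mult_right_le_imp_le) simp
qed

text \<open>Only the branches for answers \<open>a\<close> and \<open>b\<close> are reachable, so
  the reachable part is a binary tree of depth at most \<open>q\<close>, with fewer than
  \<open>2 ^ q\<close> query nodes.\<close>

lemma card_reachable_queries:
  assumes "\<And>x. x \<in> D \<Longrightarrow> length (queries t x) \<le> q"
    and "\<And>x i. x \<in> D \<Longrightarrow> i \<in> set (queries t x) \<Longrightarrow> x i = a \<or> x i = b"
  shows "finite (\<Union>x\<in>D. set (queries t x)) \<and> card (\<Union>x\<in>D. set (queries t x)) < 2 ^ q"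
  using assms
proof (induction t arbitrary: D q)
  case (Query i k)
  show ?case
  proof (cases "D = {}")
    case False
    then obtain q' where q: "q = Suc q'"
      using Query.prems(1) by (cases q) fastforce+
    \<comment> \<open>Splitting the inputs by the first answer keeps the hypotheses valid for each
      subtree, hence the induction over arbitrary \<open>D\<close>.\<close>
    define U where "U c = (\<Union>x\<in>{x \<in> D. x i = c}. set (queries (k c) x))" for c
    have U: "finite (U c) \<and> card (U c) < 2 ^ q'" for c
      unfolding U_def
    proof (rule Query.IH)
      show "length (queries (k c) x) \<le> q'" if "x \<in> {x \<in> D. x i = c}" for x
        using Query.prems(1)[of x] that q by auto
      show "x j = a \<or> x j = b" if "x \<in> {x \<in> D. x i = c}" "j \<in> set (queries (k c) x)" for x j
        using Query.prems(2)[of x j] that by auto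
    qed auto
    let ?S = "\<Union>x\<in>D. set (queries (Query i k) x)"
    have sub: "?S \<subseteq> insert i (U a \<union> U b)"
      using Query.prems(2)[of _ i] by (fastforce simp: U_def)
    have fin: "finite (insert i (U a \<union> U b))"
      using U by simp
    have "card ?S \<le> card (insert i (U a \<union> U b))"
      using sub fin by (rule card_mono[rotated])
    also have "\<dots> \<le> Suc (card (U a) + card (U b))"
      using card_Un_le[of "U a" "U b"] U by (simp add: card_insert_if)
    \<comment> \<open>Here \<open>1 + 2 * (2 ^ q' - 1) = 2 ^ q - 1\<close>.\<close>
    also have "\<dots> < 2 ^ q"
      using U[of a] U[of b] by (simp add: q)
    finally show ?thesis
      using finite_subset[OF sub fin] by simp
  qed simp
qed simp

theorem theorem7p8:
  fixes err :: error_type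
  shows "(\<exists>c::real. c > 0 \<and> (\<forall>\<^sub>F h::nat in at_top. \<forall>q A.
            balancing_test err h (1 / 4) q A \<and> non_adaptive (binary_assignments h) A \<longrightarrow>
            real q \<ge> c * real h))
       \<and> (\<exists>c::real. c > 0 \<and> (\<forall>\<^sub>F h::nat in at_top. \<forall>q A.
            balancing_test err h (1 / 4) q A \<longrightarrow>
            real q \<ge> c * log 2 (real h)))"
proof -
  have nonadaptive: "real q \<ge> 1 / 24 * real h"
    if "h \<ge> 6" "balancing_test err h (1 / 4) q A" "non_adaptive (binary_assignments h) A" for h q A
  proof -
    obtain x0 where x0: "x0 \<in> binary_assignments h"
      using patterned_binary by blast
    have "card (\<Union>x \<in> binary_assignments h. set (queries t x)) \<le> q" if t: "t \<in> set_pmf A" for t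
    proof -
      have "queries t x = queries t x0" if "x \<in> binary_assignments h" for x
        using \<open>non_adaptive _ _\<close> t x0 that unfolding non_adaptive_def by blast
      then have "(\<Union>x \<in> binary_assignments h. set (queries t x)) = set (queries t x0)"
        by (intro UN_constant_eq[OF x0]) auto
      moreover have "length (queries t x0) \<le> q"
        using \<open>balancing_test _ _ _ _ _\<close> t x0 by (simp add: balancing_test_def is_test_def)
      ultimately show ?thesis
        using card_length[of "queries t x0"] by simp
    qed
    from balancing_test_query_set_bound[OF that(2) this]
    have "h div 4 \<le> 3 * q" by simp
    \<comment> \<open>Since \<open>h div 4\<close> is positive, \<open>q \<ge> 1\<close>, and so
      \<open>h \<le> 12 * q + 3 \<le> 24 * q\<close>.\<close>
    then show ?thesis
      using that(1) by linarith
  qed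
  have adaptive: "real q \<ge> 1 / 2 * log 2 (real h)"
    if "h \<ge> 576" "balancing_test err h (1 / 4) q A" for h q A
  proof -
    have "card (\<Union>x \<in> binary_assignments h. set (queries t x)) \<le> 2 ^ q" if t: "t \<in> set_pmf A" for t
    proof -
      have "x i = Sym0 \<or> x i = Sym1" if "x \<in> binary_assignments h" "i \<in> set (queries t x)" for x i
      proof -
        have "i \<in> {..<2 ^ h}"
          using \<open>balancing_test _ _ _ _ _\<close> t that unfolding balancing_test_def is_test_def by blast
        then show ?thesis
          using that unfolding binary_assignments_def by blast
      qed
      moreover have "length (queries t x) \<le> q" if "x \<in> binary_assignments h" for x
        using \<open>balancing_test _ _ _ _ _\<close> t that by (simp add: balancing_test_def is_test_def)
      ultimately show ?thesis
        using card_reachable_queries[of "binary_assignments h" t q Sym0 Sym1] less_imp_le by blast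
    qed
    from balancing_test_query_set_bound[OF that(2) this]
    have "real (h div 4) \<le> 3 * 2 ^ q" by simp
    moreover have "real h \<le> 8 * real (h div 4)"
      using that(1) by linarith
    ultimately have "real h \<le> 24 * 2 ^ q"
      by linarith
    \<comment> \<open>The threshold is \<open>24 ^ 2\<close>: the factor 24 is absorbed by one
      \<open>sqrt (real h)\<close>, at the price of the constant 1/2 before the logarithm.\<close>
    have "24 = sqrt 576" by simp
    also have "\<dots> \<le> sqrt (real h)"
      using that(1) by (intro real_sqrt_le_mono) simp
    finally have "24 * sqrt (real h) \<le> sqrt (real h) * sqrt (real h)"
      by (intro mult_right_mono) auto
    then have "sqrt (real h) \<le> 2 ^ q"
      using \<open>real h \<le> 24 * 2 ^ q\<close> by simp
    then have "log 2 (sqrt (real h)) \<le> log 2 (2 ^ q)"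
      using that(1) by (intro log_mono) auto
    moreover have "log 2 (sqrt (real h)) = 1 / 2 * log 2 (real h)"
      using that(1) by (simp add: log_def ln_sqrt)
    ultimately show ?thesis
      by simp
  qed
  have "\<forall>\<^sub>F h::nat in at_top. \<forall>q A.
      balancing_test err h (1 / 4) q A \<and> non_adaptive (binary_assignments h) A \<longrightarrow> real q \<ge> 1 / 24 * real h"
    using eventually_ge_at_top[of 6] by eventually_elim (use nonadaptive in blast)
  moreover have "\<forall>\<^sub>F h::nat in at_top. \<forall>q A.
      balancing_test err h (1 / 4) q A \<longrightarrow> real q \<ge> 1 / 2 * log 2 (real h)"
    using eventually_ge_at_top[of 576] by eventually_elim (use adaptive in blast)
  moreover have "1 / 24 > (0 :: real)" "1 / 2 > (0 :: real)"
    by simp_all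
  ultimately show ?thesis
    by blast
qed

end
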